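(* Let $M$ and $N$ be two monoids, let $A$ be an $M$-act, and let $B$ be an $N$-act. If $A\wr B$ is a finitely presented $\mathcal{W}(M,N|A)$-act, then $A$ is a finitely presented $M$-act and $B$ is a finitely presented $N$-act.
   Context: For a monoid $M$ with identity $1$, an $M$-act is a non-empty set $A$ with a map $A\times M\to A$, $(a,m)\mapsto am$, such that $a(mn)=(am)n$ and $a1=a$. For a non-empty set $X$, $F_X$ is the free $M$-act $X\times M$ with action $(x,m)n=(x,mn)$. A congruence on an $M$-act is an equivalence relation $\rho$ such that $(a,b)\in\rho$ implies $(am,bm)\in\rho$ for all $m\in M$. An $M$-act $A$ is defined by the presentation $\langle X\,|\,R\rangle$, where $R\subseteq F_X\times F_X$, if $A\cong F_X/\rho$ with $\rho$ the smallest congruence on $F_X$ containing $R$; $A$ is finitely presented if it is defined by some presentation $\langle X\,|\,R\rangle$ with $X$ and $R$ finite. Wreath products: let $M,N$ be monoids, $A$ an $M$-act, $B$ an $N$-act. $N^A$ is the monoid of all maps $A\to N$ (written on the right) under pointwise multiplication $a(\theta\phi)=(a\theta)(a\phi)$. For $m\in M$ and $\phi\in N^A$, ${}^m\phi\in N^A$ is given by $a\,{}^m\phi=(am)\phi$. The monoid $\mathcal{W}(M,N|A)$ is the set $M\times N^A$ with multiplication $(m,\theta)(n,\phi)=(mn,\theta\,{}^m\phi)$. The wreath product $A\wr B$ is the $\mathcal{W}(M,N|A)$-act with underlying set $A\times B$ and action $(a,b)(m,\theta)=(am,b(a\theta))$. *)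

theory Defs
  imports "HOL-Algebra.Product_Groups"
begin

text \<open>
  Right acts over a monoid. Only the values of \<open>act\<close> at a point of \<open>points\<close> and an element
  of the carrier of the monoid are meaningful.
\<close>

record ('m, 'a) right_act =
  points :: "'a set"
  act :: "'a \<Rightarrow> 'm \<Rightarrow> 'a"

locale monoid_act = monoid M for M (structure) +
  fixes A :: "('m, 'a) right_act"
  assumes points_nonempty: "points A \<noteq> {}"
    and act_closed: "\<lbrakk>a \<in> points A; m \<in> carrier M\<rbrakk> \<Longrightarrow> act A a m \<in> points A"
    and act_mult: "\<lbrakk>a \<in> points A; m \<in> carrier M; n \<in> carrier M\<rbrakk>
      \<Longrightarrow> act A a (m \<otimes> n) = act A (act A a m) n"
    and act_one: "a \<in> points A \<Longrightarrow> act A a \<one> = a"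

definition act_isomorphic ::
    "('m, 'k) monoid_scheme \<Rightarrow> ('m, 'a) right_act \<Rightarrow> ('m, 'b) right_act \<Rightarrow> bool" where
  "act_isomorphic M A B \<longleftrightarrow>
     (\<exists>f. bij_betw f (points A) (points B) \<and>
          (\<forall>a\<in>points A. \<forall>m\<in>carrier M. f (act A a m) = act B (f a) m))"

definition act_congruence ::
    "('m, 'k) monoid_scheme \<Rightarrow> ('m, 'a) right_act \<Rightarrow> ('a \<times> 'a) set \<Rightarrow> bool" where
  "act_congruence M A \<rho> \<longleftrightarrow>
     equiv (points A) \<rho> \<and> (\<forall>(a, b)\<in>\<rho>. \<forall>m\<in>carrier M. (act A a m, act A b m) \<in> \<rho>)"

definition generated_congruence ::
    "('m, 'k) monoid_scheme \<Rightarrow> ('m, 'a) right_act \<Rightarrow> ('a \<times> 'a) set \<Rightarrow> ('a \<times> 'a) set" where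
  "generated_congruence M A R = \<Inter>{\<rho>. act_congruence M A \<rho> \<and> R \<subseteq> \<rho>}"

text \<open>
  The action on classes is given by a union over representatives, as in
  \<open>HOL.Equiv_Relations\<close>: for a congruence it is the class of \<open>act A c m\<close> for any \<open>c \<in> C\<close>.
\<close>

definition quotient_act ::
    "('m, 'a) right_act \<Rightarrow> ('a \<times> 'a) set \<Rightarrow> ('m, 'a set) right_act" where
  "quotient_act A \<rho> = \<lparr>points = points A // \<rho>, act = (\<lambda>C m. \<Union>c\<in>C. \<rho> `` {act A c m})\<rparr>"

definition free_act ::
    "('m, 'k) monoid_scheme \<Rightarrow> 'x set \<Rightarrow> ('m, 'x \<times> 'm) right_act" where
  "free_act M X = \<lparr>points = X \<times> carrier M, act = (\<lambda>(x, m) n. (x, m \<otimes>\<^bsub>M\<^esub> n))\<rparr>"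

definition presented_by ::
    "('m, 'k) monoid_scheme \<Rightarrow> ('m, 'a) right_act \<Rightarrow> 'x set
       \<Rightarrow> (('x \<times> 'm) \<times> ('x \<times> 'm)) set \<Rightarrow> bool" where
  "presented_by M A X R \<longleftrightarrow>
     X \<noteq> {} \<and> R \<subseteq> points (free_act M X) \<times> points (free_act M X) \<and>
     act_isomorphic M A
       (quotient_act (free_act M X) (generated_congruence M (free_act M X) R))"

text \<open>
  A definition cannot quantify over the type of generators. Since every finite set is in
  bijection with a finite set of natural numbers, and renaming generators does not change the
  act presented, taking the generators to be natural numbers loses no generality.
\<close>

definition finitely_presented_act ::
    "('m, 'k) monoid_scheme \<Rightarrow> ('m, 'a) right_act \<Rightarrow> bool" where
  "finitely_presented_act M A \<longleftrightarrow>
     (\<exists>(X :: nat set) R. finite X \<and> finite R \<and> presented_by M A X R)"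

text \<open>
  The monoid \<open>N^A\<close> is \<open>product_group (points A) (\<lambda>_. N)\<close>, which despite its name makes sense for
  monoids; a map \<open>A \<rightarrow> N\<close> is represented by a function that is \<open>undefined\<close> off \<open>points A\<close>.
\<close>

definition twist ::
    "('m, 'a) right_act \<Rightarrow> 'm \<Rightarrow> ('a \<Rightarrow> 'n) \<Rightarrow> ('a \<Rightarrow> 'n)" where
  "twist A m \<phi> = (\<lambda>a\<in>points A. \<phi> (act A a m))"

definition wreath_monoid ::
    "('m, 'k) monoid_scheme \<Rightarrow> ('n, 'l) monoid_scheme \<Rightarrow> ('m, 'a) right_act
       \<Rightarrow> ('m \<times> ('a \<Rightarrow> 'n)) monoid" where
  "wreath_monoid M N A =
     (let P = product_group (points A) (\<lambda>_. N) in
      \<lparr>carrier = carrier M \<times> carrier P,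
       monoid.mult = (\<lambda>(m, \<theta>) (n, \<phi>). (m \<otimes>\<^bsub>M\<^esub> n, \<theta> \<otimes>\<^bsub>P\<^esub> twist A m \<phi>)),
       one = (\<one>\<^bsub>M\<^esub>, \<one>\<^bsub>P\<^esub>)\<rparr>)"

definition wreath_act ::
    "('m, 'a) right_act \<Rightarrow> ('n, 'b) right_act \<Rightarrow> ('m \<times> ('a \<Rightarrow> 'n), 'a \<times> 'b) right_act" where
  "wreath_act A B =
     \<lparr>points = points A \<times> points B,
      act = (\<lambda>(a, b) (m, \<theta>). (act A a m, act B b (\<theta> a)))\<rparr>"

lemma wreath_monoid_simps [simp]:
  "carrier (wreath_monoid M N A) = carrier M \<times> (points A \<rightarrow>\<^sub>E carrier N)"
  "(m, \<theta>) \<otimes>\<^bsub>wreath_monoid M N A\<^esub> (n, \<phi>) =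
     (m \<otimes>\<^bsub>M\<^esub> n, \<lambda>a\<in>points A. \<theta> a \<otimes>\<^bsub>N\<^esub> \<phi> (act A a m))"
  "\<one>\<^bsub>wreath_monoid M N A\<^esub> = (\<one>\<^bsub>M\<^esub>, \<lambda>a\<in>points A. \<one>\<^bsub>N\<^esub>)"
  by (auto simp: wreath_monoid_def twist_def Let_def restrict_def)

lemma wreath_act_simps [simp]:
  "points (wreath_act A B) = points A \<times> points B"
  "act (wreath_act A B) (a, b) (m, \<theta>) = (act A a m, act B b (\<theta> a))"
  by (simp_all add: wreath_act_def)

lemma monoid_wreath_monoid:
  assumes "monoid_act M A" and "monoid N"
  shows "monoid (wreath_monoid M N A)"
proof -
  interpret A: monoid_act M A by fact
  interpret N: monoid N by fact
  show ?thesis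
  proof (rule monoidI, goal_cases)
    case (1 x y)
    then show ?case
      by (cases x; cases y) (auto intro!: N.m_closed A.act_closed)
  next
    case 2
    then show ?case by auto
  next
    case (3 x y z)
    then obtain m n k \<theta> \<phi> \<psi> where xyz: "x = (m, \<theta>)" "y = (n, \<phi>)" "z = (k, \<psi>)"
      and mem: "m \<in> carrier M" "n \<in> carrier M" "k \<in> carrier M"
        "\<theta> \<in> points A \<rightarrow>\<^sub>E carrier N" "\<phi> \<in> points A \<rightarrow>\<^sub>E carrier N" "\<psi> \<in> points A \<rightarrow>\<^sub>E carrier N"
      by (cases x; cases y; cases z) auto
    have "\<theta> a \<otimes>\<^bsub>N\<^esub> \<phi> (act A a m) \<otimes>\<^bsub>N\<^esub> \<psi> (act A (act A a m) n) =
        \<theta> a \<otimes>\<^bsub>N\<^esub> (\<phi> (act A a m) \<otimes>\<^bsub>N\<^esub> \<psi> (act A (act A a m) n))" if "a \<in> points A" for a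
      using that mem by (intro N.m_assoc) (auto intro!: A.act_closed)
    with mem show ?case
      unfolding xyz by (auto intro!: restrict_ext simp: A.act_closed A.act_mult A.m_assoc)
  next
    case (4 x)
    then obtain m \<theta> where x: "x = (m, \<theta>)" "m \<in> carrier M" "\<theta> \<in> points A \<rightarrow>\<^sub>E carrier N"
      by (cases x) auto
    have "(\<lambda>a\<in>points A. \<one>\<^bsub>N\<^esub> \<otimes>\<^bsub>N\<^esub> \<theta> (act A a \<one>\<^bsub>M\<^esub>)) = restrict \<theta> (points A)"
      by (rule restrict_ext) (simp add: A.act_one N.l_one[OF PiE_mem[OF x(3)]])
    with x show ?case
      by (simp add: PiE_restrict cong: restrict_cong)
  next
    case (5 x)
    then obtain m \<theta> where x: "x = (m, \<theta>)" "m \<in> carrier M" "\<theta> \<in> points A \<rightarrow>\<^sub>E carrier N"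
      by (cases x) auto
    have "(\<lambda>a\<in>points A. \<theta> a \<otimes>\<^bsub>N\<^esub> (\<lambda>a\<in>points A. \<one>\<^bsub>N\<^esub>) (act A a m)) = restrict \<theta> (points A)"
      by (rule restrict_ext) (simp add: A.act_closed x(2) N.r_one[OF PiE_mem[OF x(3)]])
    with x show ?case
      by (simp add: PiE_restrict)
  qed
qed

lemma monoid_act_wreath_act:
  assumes "monoid_act M A" and "monoid_act N B"
  shows "monoid_act (wreath_monoid M N A) (wreath_act A B)"
proof -
  interpret A: monoid_act M A by fact
  interpret B: monoid_act N B by fact
  show ?thesis
  proof (rule monoid_act.intro)
    show "monoid (wreath_monoid M N A)"
      by (rule monoid_wreath_monoid) (fact assms(1), unfold_locales)
    show "monoid_act_axioms (wreath_monoid M N A) (wreath_act A B)"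
    proof (rule monoid_act_axioms.intro, goal_cases)
      case 1
      then show ?case using A.points_nonempty B.points_nonempty by simp
    next
      case (2 a m)
      then show ?case
        by (cases a; cases m) (auto intro!: A.act_closed B.act_closed)
    next
      case (3 a m n)
      then show ?case
        by (cases a; cases m; cases n)
          (auto intro!: B.act_mult A.act_closed simp: A.act_mult)
    next
      case (4 a)
      then show ?case
        by (cases a) (auto simp: A.act_one B.act_one)
    qed
  qed
qed

lemma act_congruence_generated:
  assumes "monoid_act M A" and "R \<subseteq> points A \<times> points A"
  shows "act_congruence M A (generated_congruence M A R)"
    (is "act_congruence M A ?G")
proof -
  interpret A: monoid_act M A by fact
  have full: "act_congruence M A (points A \<times> points A)"
    by (simp add: act_congruence_def equiv_def refl_on_def sym_def trans_def A.act_closed)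
  have G_iff: "p \<in> ?G \<longleftrightarrow> (\<forall>\<rho>. act_congruence M A \<rho> \<longrightarrow> R \<subseteq> \<rho> \<longrightarrow> p \<in> \<rho>)" for p
    unfolding generated_congruence_def by blast
  have cong: "refl_on (points A) \<rho>" "sym \<rho>" "trans \<rho>"
    "\<And>a b m. \<lbrakk>(a, b) \<in> \<rho>; m \<in> carrier M\<rbrakk> \<Longrightarrow> (act A a m, act A b m) \<in> \<rho>"
    if "act_congruence M A \<rho>" for \<rho>
    using that unfolding act_congruence_def equiv_def by blast+
  have "equiv (points A) ?G"
  proof (rule equivI)
    show "?G \<subseteq> points A \<times> points A"
      unfolding generated_congruence_def using full assms(2) by (intro Inter_lower) simp
    show "refl_on (points A) ?G"
      by (rule refl_onI) (simp add: G_iff refl_onD[OF cong(1)])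
    show "sym ?G"
      by (rule symI) (use symD[OF cong(2)] in \<open>simp add: G_iff\<close>)
    show "trans ?G"
    proof (rule transI)
      fix a b c assume "(a, b) \<in> ?G" "(b, c) \<in> ?G"
      then show "(a, c) \<in> ?G"
        unfolding G_iff using transD[OF cong(3)] by meson
    qed
  qed
  moreover have "(act A a m, act A b m) \<in> ?G" if "(a, b) \<in> ?G" "m \<in> carrier M" for a b m
    using that cong(4) unfolding G_iff by meson
  ultimately show ?thesis
    unfolding act_congruence_def by blast
qed

lemma monoid_act_free_act:
  assumes "monoid M" and "X \<noteq> {}"
  shows "monoid_act M (free_act M X)"
proof -
  interpret monoid M by fact
  show ?thesis
  proof
    show "points (free_act M X) \<noteq> {}"
      using assms(2) by (auto simp: free_act_def)
  qed (auto simp: free_act_def m_assoc)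
qed

lemma monoid_act_quotient_act:
  assumes "monoid_act M A" and "act_congruence M A \<rho>"
  shows "monoid_act M (quotient_act A \<rho>)"
    and "\<lbrakk>a \<in> points A; m \<in> carrier M\<rbrakk> \<Longrightarrow>
      act (quotient_act A \<rho>) (\<rho> `` {a}) m = \<rho> `` {act A a m}"
proof -
  interpret A: monoid_act M A by fact
  have eq: "equiv (points A) \<rho>"
    using assms(2) by (simp add: act_congruence_def)
  have class_act: "act (quotient_act A \<rho>) (\<rho> `` {a}) m = \<rho> `` {act A a m}"
    if "a \<in> points A" "m \<in> carrier M" for a m
  proof -
    have "(\<lambda>c. \<rho> `` {act A c m}) respects \<rho>"
      using assms(2) that(2) eq
      by (auto simp: congruent_def act_congruence_def intro!: equiv_class_eq[OF eq])
    from UN_equiv_class[OF eq this that(1)] show ?thesis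
      by (simp add: quotient_act_def)
  qed
  then show "\<lbrakk>a \<in> points A; m \<in> carrier M\<rbrakk> \<Longrightarrow>
    act (quotient_act A \<rho>) (\<rho> `` {a}) m = \<rho> `` {act A a m}" .
  have pts: "points (quotient_act A \<rho>) = points A // \<rho>"
    by (simp add: quotient_act_def)
  show "monoid_act M (quotient_act A \<rho>)"
  proof
    show "points (quotient_act A \<rho>) \<noteq> {}"
      using A.points_nonempty by (auto simp: pts quotient_def)
  next
    fix C m assume "C \<in> points (quotient_act A \<rho>)" "m \<in> carrier M"
    then show "act (quotient_act A \<rho>) C m \<in> points (quotient_act A \<rho>)"
      unfolding pts by (elim quotientE) (simp add: class_act A.act_closed quotientI)
  next
    fix C m n assume "C \<in> points (quotient_act A \<rho>)" "m \<in> carrier M" "n \<in> carrier M"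
    then show "act (quotient_act A \<rho>) C (m \<otimes>\<^bsub>M\<^esub> n) =
        act (quotient_act A \<rho>) (act (quotient_act A \<rho>) C m) n"
      unfolding pts by (elim quotientE) (simp add: class_act A.act_closed A.act_mult)
  next
    fix C assume "C \<in> points (quotient_act A \<rho>)"
    then show "act (quotient_act A \<rho>) C \<one>\<^bsub>M\<^esub> = C"
      unfolding pts by (elim quotientE) (simp add: class_act A.act_one)
  qed
qed

end

theory Submission
  imports Defs
begin

text \<open>
  Both halves are instances of one transfer principle. Suppose that \<open>p : C \<rightarrow> D\<close> carries the
  action of \<open>W\<close> on \<open>C\<close> to that of \<open>V\<close> on \<open>D\<close> along a cocycle \<open>e\<close>, that is,
  \<open>p (c w) = p c (e c w)\<close> with \<open>e c (w w') = (e c w) (e (c w) w')\<close>, and that \<open>p\<close> has a section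
  \<open>i\<close>, equivariant along some \<open>j : V \<rightarrow> W\<close> with \<open>e (i d) (j v) = v\<close>. If \<open>C\<close> has generators
  \<open>c x\<close> and relations \<open>R\<close>, then \<open>D\<close> has generators \<open>d x = p (c x)\<close>; its relations are the
  images of \<open>R\<close> under \<open>(x, w) \<mapsto> (x, e (c x) w)\<close> together with one relation
  \<open>(x, 1) = (z, e (c z) w)\<close> for each \<open>x\<close>, where \<open>z\<close> and \<open>w\<close> are chosen with
  \<open>i (d x) = c z w\<close>. Indeed, if \<open>d x s = d y t\<close>, then applying \<open>i\<close> gives an equation between
  elements of \<open>C\<close>, which follows from \<open>R\<close> and is mapped back by \<open>e\<close>.

  For \<open>A\<close> one takes \<open>p = fst\<close> and \<open>e (a, b) (m, \<theta>) = m\<close>; for \<open>B\<close> one takes \<open>p = snd\<close> and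
  \<open>e (a, b) (m, \<theta>) = \<theta> a\<close>.
\<close>

section \<open>Presentations as kernels of evaluation maps\<close>

lemma free_act_simps [simp]:
  "points (free_act M X) = X \<times> carrier M"
  "act (free_act M X) (x, m) n = (x, m \<otimes>\<^bsub>M\<^esub> n)"
  by (simp_all add: free_act_def)

lemma generated_congruence_least:
  assumes "act_congruence M A \<rho>" and "R \<subseteq> \<rho>"
  shows "generated_congruence M A R \<subseteq> \<rho>"
  using assms unfolding generated_congruence_def by blast

lemma generated_congruence_superset: "R \<subseteq> generated_congruence M A R"
  unfolding generated_congruence_def by blast

lemma act_congruence_act:
  assumes "act_congruence M A \<rho>" and "(a, b) \<in> \<rho>" and "m \<in> carrier M"
  shows "(act A a m, act A b m) \<in> \<rho>"
  using assms unfolding act_congruence_def by blast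

text \<open>The kernel of the homomorphism from the free act to \<open>A\<close> that sends each
  generator \<open>x\<close> to \<open>c x\<close>.\<close>

definition evaluation_kernel ::
    "('m, 'k) monoid_scheme \<Rightarrow> ('m, 'a) right_act \<Rightarrow> 'x set \<Rightarrow> ('x \<Rightarrow> 'a)
       \<Rightarrow> (('x \<times> 'm) \<times> ('x \<times> 'm)) set" where
  "evaluation_kernel M A X c =
     {((x, m), (y, n)). x \<in> X \<and> m \<in> carrier M \<and> y \<in> X \<and> n \<in> carrier M \<and>
        act A (c x) m = act A (c y) n}"

lemma evaluation_kernel_iff [simp]:
  "((x, m), (y, n)) \<in> evaluation_kernel M A X c \<longleftrightarrow>
     x \<in> X \<and> m \<in> carrier M \<and> y \<in> X \<and> n \<in> carrier M \<and> act A (c x) m = act A (c y) n"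
  by (simp add: evaluation_kernel_def)

lemma act_congruence_evaluation_kernel:
  assumes "monoid_act M A" and "c \<in> X \<rightarrow> points A"
  shows "act_congruence M (free_act M X) (evaluation_kernel M A X c)"
proof -
  interpret monoid_act M A by fact
  have c: "c x \<in> points A" if "x \<in> X" for x
    using assms(2) that by auto
  have "equiv (X \<times> carrier M) (evaluation_kernel M A X c)"
    by (rule equivI) (auto simp: evaluation_kernel_def refl_on_def sym_def trans_def)
  then show ?thesis
    unfolding act_congruence_def by (auto simp: evaluation_kernel_def act_mult c)
qed

text \<open>Together with \<open>presented_byI\<close> this trades the isomorphism with a quotient
  for generators inside \<open>A\<close>, so that the transfer argument compares elements rather
  than classes.\<close>

lemma presented_byE:
  assumes "monoid_act M A" and "presented_by M A X R"
  obtains c where "c \<in> X \<rightarrow> points A"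
    and "\<And>a. a \<in> points A \<Longrightarrow> \<exists>x\<in>X. \<exists>m\<in>carrier M. a = act A (c x) m"
    and "generated_congruence M (free_act M X) R = evaluation_kernel M A X c"
proof -
  interpret monoid_act M A by fact
  let ?F = "free_act M X"
  define \<rho> where "\<rho> = generated_congruence M ?F R"
  define Q where "Q = quotient_act ?F \<rho>"
  have X: "X \<noteq> {}" and R: "R \<subseteq> points ?F \<times> points ?F" and "act_isomorphic M A Q"
    using assms(2) by (auto simp: presented_by_def \<rho>_def Q_def)
  then obtain f where f: "bij_betw f (points A) (points Q)"
    and hom: "\<And>a m. \<lbrakk>a \<in> points A; m \<in> carrier M\<rbrakk> \<Longrightarrow> f (act A a m) = act Q (f a) m"
    unfolding act_isomorphic_def by blast
  have F: "monoid_act M ?F"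
    using X by (intro monoid_act_free_act monoid_axioms)
  have cong: "act_congruence M ?F \<rho>"
    unfolding \<rho>_def by (rule act_congruence_generated[OF F R])
  then have eq: "equiv (X \<times> carrier M) \<rho>"
    by (simp add: act_congruence_def)
  have Q: "points Q = (X \<times> carrier M) // \<rho>"
    by (simp add: Q_def quotient_act_def)
  \<comment> \<open>The point of \<open>A\<close> that the isomorphism sends to the class of the
    free generator \<open>x\<close>.\<close>
  define c where "c x = inv_into (points A) f (\<rho> `` {(x, \<one>\<^bsub>M\<^esub>)})" for x
  have gen: "\<rho> `` {(x, \<one>\<^bsub>M\<^esub>)} \<in> f ` points A" if "x \<in> X" for x
    using that f by (auto simp: bij_betw_def Q intro!: quotientI)
  have c: "c x \<in> points A" "f (c x) = \<rho> `` {(x, \<one>\<^bsub>M\<^esub>)}" if "x \<in> X" for x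
    unfolding c_def using inv_into_into[OF gen[OF that]] f_inv_into_f[OF gen[OF that]] by auto
  have fc: "f (act A (c x) m) = \<rho> `` {(x, m)}" if "x \<in> X" "m \<in> carrier M" for x m
    using that hom c monoid_act_quotient_act(2)[OF F cong, of "(x, \<one>\<^bsub>M\<^esub>)" m]
    by (simp add: Q_def)
  have inj: "inj_on f (points A)"
    using f by (simp add: bij_betw_def)
  show thesis
  proof
    show "c \<in> X \<rightarrow> points A"
      using c by auto
  next
    fix a assume a: "a \<in> points A"
    then have "f a \<in> (X \<times> carrier M) // \<rho>"
      using f by (auto simp: bij_betw_def Q)
    then obtain x m where xm: "x \<in> X" "m \<in> carrier M" "f a = \<rho> `` {(x, m)}"
      by (auto elim: quotientE)
    then have "a = act A (c x) m"
      using a by (intro inj_onD[OF inj]) (auto simp: fc c act_closed)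
    with xm show "\<exists>x\<in>X. \<exists>m\<in>carrier M. a = act A (c x) m"
      by blast
  next
    have "((x, m), (y, n)) \<in> \<rho> \<longleftrightarrow> ((x, m), (y, n)) \<in> evaluation_kernel M A X c" for x m y n
    proof -
      have "\<rho> `` {(x, m)} = \<rho> `` {(y, n)} \<longleftrightarrow> act A (c x) m = act A (c y) n"
        if "x \<in> X" "m \<in> carrier M" "y \<in> X" "n \<in> carrier M"
        using that inj_on_eq_iff[OF inj] by (simp flip: fc add: c act_closed)
      then show ?thesis
        by (auto simp: equiv_class_eq_iff[OF eq])
    qed
    then show "generated_congruence M ?F R = evaluation_kernel M A X c"
      unfolding \<rho>_def[symmetric] by (auto simp: set_eq_iff)
  qed
qed

lemma presented_byI:
  assumes "monoid_act M A" and "X \<noteq> {}" and "c \<in> X \<rightarrow> points A"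
    and surj: "\<And>a. a \<in> points A \<Longrightarrow> \<exists>x\<in>X. \<exists>m\<in>carrier M. a = act A (c x) m"
    and ker: "generated_congruence M (free_act M X) R = evaluation_kernel M A X c"
  shows "presented_by M A X R"
proof -
  interpret monoid_act M A by fact
  let ?F = "free_act M X"
  define \<rho> where "\<rho> = evaluation_kernel M A X c"
  define Q where "Q = quotient_act ?F \<rho>"
  have F: "monoid_act M ?F"
    using assms(2) by (intro monoid_act_free_act monoid_axioms)
  have cong: "act_congruence M ?F \<rho>"
    unfolding \<rho>_def by (rule act_congruence_evaluation_kernel[OF assms(1,3)])
  have c: "c x \<in> points A" if "x \<in> X" for x
    using assms(3) that by auto
  \<comment> \<open>The inverse of the induced isomorphism: \<open>f a\<close> is the fibre of the
    evaluation map over \<open>a\<close>, which is a class of its kernel. Surjectivity makes it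
    non-empty, so it determines \<open>a\<close>.\<close>
  define f where "f a = {(x, m). x \<in> X \<and> m \<in> carrier M \<and> act A (c x) m = a}" for a
  have f: "f (act A (c x) m) = \<rho> `` {(x, m)}" if "x \<in> X" "m \<in> carrier M" for x m
    using that by (auto simp: f_def \<rho>_def)
  have "inj_on f (points A)"
  proof (rule inj_onI)
    fix a b assume "a \<in> points A" "f a = f b"
    moreover from surj[OF \<open>a \<in> points A\<close>] have "f a \<noteq> {}"
      by (auto simp: f_def)
    ultimately show "a = b"
      by (auto simp: f_def)
  qed
  moreover have "f ` points A = (X \<times> carrier M) // \<rho>"
  proof
    show "f ` points A \<subseteq> (X \<times> carrier M) // \<rho>"
      using surj by (fastforce simp: f intro: quotientI)
    show "(X \<times> carrier M) // \<rho> \<subseteq> f ` points A"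
      by (auto elim!: quotientE simp flip: f intro!: imageI act_closed c)
  qed
  ultimately have bij: "bij_betw f (points A) (points Q)"
    by (simp add: bij_betw_def Q_def quotient_act_def)
  have "f (act A a n) = act Q (f a) n" if "a \<in> points A" "n \<in> carrier M" for a n
  proof -
    obtain x m where xm: "x \<in> X" "m \<in> carrier M" "a = act A (c x) m"
      using surj \<open>a \<in> points A\<close> by blast
    then have "act A a n = act A (c x) (m \<otimes>\<^bsub>M\<^esub> n)"
      using c that by (simp add: act_mult)
    then show ?thesis
      using xm that monoid_act_quotient_act(2)[OF F cong, of "(x, m)" n]
      by (simp add: f Q_def)
  qed
  with bij have "act_isomorphic M A Q"
    unfolding act_isomorphic_def by blast
  moreover have "R \<subseteq> points ?F \<times> points ?F"
    using generated_congruence_superset[of R M ?F] unfolding ker evaluation_kernel_def by auto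
  ultimately show ?thesis
    using assms(2) by (simp add: presented_by_def ker Q_def \<rho>_def)
qed

section \<open>Transfer of finite presentability along a cocycle\<close>

lemma finitely_presented_act_transfer:
  assumes "monoid_act W C" and "monoid_act V D"
    and p: "\<And>c. c \<in> points C \<Longrightarrow> p c \<in> points D"
    and e: "\<And>c w. \<lbrakk>c \<in> points C; w \<in> carrier W\<rbrakk> \<Longrightarrow> e c w \<in> carrier V"
    and e_mult: "\<And>c w w'. \<lbrakk>c \<in> points C; w \<in> carrier W; w' \<in> carrier W\<rbrakk> \<Longrightarrow>
      e c (w \<otimes>\<^bsub>W\<^esub> w') = e c w \<otimes>\<^bsub>V\<^esub> e (act C c w) w'"
    and p_act: "\<And>c w. \<lbrakk>c \<in> points C; w \<in> carrier W\<rbrakk> \<Longrightarrow> p (act C c w) = act D (p c) (e c w)"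
    and i: "\<And>d. d \<in> points D \<Longrightarrow> i d \<in> points C"
    and j: "\<And>v. v \<in> carrier V \<Longrightarrow> j v \<in> carrier W"
    and p_i: "\<And>d. d \<in> points D \<Longrightarrow> p (i d) = d"
    and i_act: "\<And>d v. \<lbrakk>d \<in> points D; v \<in> carrier V\<rbrakk> \<Longrightarrow> i (act D d v) = act C (i d) (j v)"
    and e_j: "\<And>d v. \<lbrakk>d \<in> points D; v \<in> carrier V\<rbrakk> \<Longrightarrow> e (i d) (j v) = v"
    and fp: "finitely_presented_act W C"
  shows "finitely_presented_act V D"
proof -
  interpret C: monoid_act W C by fact
  interpret D: monoid_act V D by fact
  from fp obtain X :: "nat set" and R
    where fin: "finite X" "finite R" and pres: "presented_by W C X R"
    unfolding finitely_presented_act_def by blast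
  have X: "X \<noteq> {}"
    using pres by (simp add: presented_by_def)
  obtain c where c: "c \<in> X \<rightarrow> points C"
    and c_gen: "\<And>a. a \<in> points C \<Longrightarrow> \<exists>x\<in>X. \<exists>w\<in>carrier W. a = act C (c x) w"
    and R_gen: "generated_congruence W (free_act W X) R = evaluation_kernel W C X c"
    using presented_byE[OF assms(1) pres] by blast
  have c_in: "c x \<in> points C" if "x \<in> X" for x
    using c that by auto
  define d where "d x = p (c x)" for x
  have d_in: "d x \<in> points D" if "x \<in> X" for x
    using that by (simp add: d_def p c_in)
  have "\<forall>x\<in>X. \<exists>z w. z \<in> X \<and> w \<in> carrier W \<and> i (d x) = act C (c z) w"
    using c_gen i d_in by blast
  then obtain z w where zw: "\<And>x. x \<in> X \<Longrightarrow> z x \<in> X" "\<And>x. x \<in> X \<Longrightarrow> w x \<in> carrier W"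
    "\<And>x. x \<in> X \<Longrightarrow> i (d x) = act C (c (z x)) (w x)"
    by metis
  define u where "u x = e (c (z x)) (w x)" for x
  have u: "u x \<in> carrier V" if "x \<in> X" for x
    using that by (simp add: u_def e c_in zw)
  define q where "q = (\<lambda>(x, w). (x, e (c x) w))"
  define H where "H = map_prod q q ` R \<union> (\<lambda>x. ((x, \<one>\<^bsub>V\<^esub>), (z x, u x))) ` X"
  let ?F = "free_act V X"
  let ?\<sigma> = "generated_congruence V ?F H"
  have F: "monoid_act V ?F"
    using X by (intro monoid_act_free_act D.monoid_axioms)
  have d_act: "p (act C (c x) k) = act D (d x) (e (c x) k)" if "x \<in> X" "k \<in> carrier W" for x k
    using that by (simp add: p_act c_in d_def)
  \<comment> \<open>All relations in \<open>H\<close> hold in \<open>D\<close>: those coming from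
    \<open>R\<close> by applying \<open>p\<close> to equations in \<open>C\<close>, the others
    because \<open>p\<close> undoes \<open>i\<close>.\<close>
  have "R \<subseteq> evaluation_kernel W C X c"
    using generated_congruence_superset[of R W "free_act W X"] unfolding R_gen .
  then have "map_prod q q ` R \<subseteq> evaluation_kernel V D X d"
    by (fastforce simp: q_def evaluation_kernel_def e c_in simp flip: d_act)
  moreover have "((x, \<one>\<^bsub>V\<^esub>), (z x, u x)) \<in> evaluation_kernel V D X d" if "x \<in> X" for x
  proof -
    have "act D (d (z x)) (u x) = d x"
      using that d_act[of "z x" "w x"] zw p_i[OF d_in[OF that]] by (simp add: u_def)
    with that show ?thesis
      by (simp add: zw(1) u D.act_one d_in)
  qed
  ultimately have H: "H \<subseteq> evaluation_kernel V D X d"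
    by (auto simp: H_def)
  then have "H \<subseteq> points ?F \<times> points ?F"
    by (auto simp: evaluation_kernel_def)
  then have \<sigma>: "act_congruence V ?F ?\<sigma>"
    by (rule act_congruence_generated[OF F])
  then have \<sigma>_equiv: "equiv (X \<times> carrier V) ?\<sigma>"
    by (simp add: act_congruence_def)
  have \<sigma>_sym: "(b, a) \<in> ?\<sigma>" if "(a, b) \<in> ?\<sigma>" for a b
    using \<sigma>_equiv that by (auto simp: equiv_def dest: symD)
  have \<sigma>_trans: "(a, b') \<in> ?\<sigma>" if "(a, b) \<in> ?\<sigma>" "(b, b') \<in> ?\<sigma>" for a b b'
    using \<sigma>_equiv that by (auto simp: equiv_def dest: transD)
  define \<tau> where "\<tau> = {(a, b) \<in> evaluation_kernel W C X c. (q a, q b) \<in> ?\<sigma>}"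
  \<comment> \<open>The equation \<open>act C (c x) k = act C (c y) l\<close> built into \<open>\<tau>\<close> makes the cocycle
    multiply both sides by the same element of \<open>V\<close>.\<close>
  have "act_congruence W (free_act W X) \<tau>"
    unfolding act_congruence_def
  proof
    have "\<tau> \<subseteq> (X \<times> carrier W) \<times> (X \<times> carrier W)"
      by (auto simp: \<tau>_def evaluation_kernel_def)
    moreover have "(a, a) \<in> \<tau>" if "a \<in> X \<times> carrier W" for a
      using that \<sigma>_equiv by (auto simp: \<tau>_def q_def e c_in equiv_def refl_on_def)
    moreover have "sym \<tau>"
      by (rule symI) (auto simp: \<tau>_def evaluation_kernel_def intro: \<sigma>_sym)
    moreover have "trans \<tau>"
      by (rule transI) (auto simp: \<tau>_def evaluation_kernel_def intro: \<sigma>_trans)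
    ultimately show "equiv (points (free_act W X)) \<tau>"
      by (auto simp: equiv_def refl_on_def)
  next
    have "((x, k \<otimes>\<^bsub>W\<^esub> m), (y, l \<otimes>\<^bsub>W\<^esub> m)) \<in> \<tau>"
      if "((x, k), (y, l)) \<in> \<tau>" "m \<in> carrier W" for x k y l m
    proof -
      have *: "x \<in> X" "k \<in> carrier W" "y \<in> X" "l \<in> carrier W"
        "act C (c x) k = act C (c y) l" "((x, e (c x) k), (y, e (c y) l)) \<in> ?\<sigma>"
        using that by (auto simp: \<tau>_def q_def)
      then have "e (act C (c x) k) m \<in> carrier V"
        using that by (simp add: e c_in C.act_closed)
      from act_congruence_act[OF \<sigma> *(6) this] show ?thesis
        using * that by (simp add: \<tau>_def q_def e_mult c_in C.act_mult)
    qed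
    then show "\<forall>(a, b)\<in>\<tau>. \<forall>m\<in>carrier W. (act (free_act W X) a m, act (free_act W X) b m) \<in> \<tau>"
      by auto
  qed
  moreover have "R \<subseteq> \<tau>"
    using \<open>R \<subseteq> evaluation_kernel W C X c\<close> generated_congruence_superset[of H V ?F]
    by (auto simp: \<tau>_def H_def image_subset_iff)
  \<comment> \<open>By minimality, \<open>q\<close> sends both sides of every equation between
    generators of \<open>C\<close> to a pair identified by \<open>H\<close>, not only the pairs in
    \<open>R\<close>.\<close>
  ultimately have ker_\<tau>: "evaluation_kernel W C X c \<subseteq> \<tau>"
    unfolding R_gen[symmetric] by (rule generated_congruence_least)
  have normal: "((x, s), (z x, u x \<otimes>\<^bsub>V\<^esub> s)) \<in> ?\<sigma>" if "x \<in> X" "s \<in> carrier V" for x s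
  proof -
    have "((x, \<one>\<^bsub>V\<^esub>), (z x, u x)) \<in> ?\<sigma>"
      using generated_congruence_superset[of H V ?F] \<open>x \<in> X\<close> by (auto simp: H_def)
    from act_congruence_act[OF \<sigma> this \<open>s \<in> carrier V\<close>] show ?thesis
      using that by simp
  qed
  \<comment> \<open>Since \<open>c (z x)\<close> moved by \<open>w x\<close> is
    \<open>i (d x)\<close>, the cocycle rule leaves the factor \<open>e (i (d x)) (j s)\<close>,
    which is \<open>s\<close>.\<close>
  have lift: "act C (c (z x)) (w x \<otimes>\<^bsub>W\<^esub> j s) = i (act D (d x) s)"
    "e (c (z x)) (w x \<otimes>\<^bsub>W\<^esub> j s) = u x \<otimes>\<^bsub>V\<^esub> s" if "x \<in> X" "s \<in> carrier V" for x s
    using that by (simp_all add: C.act_mult e_mult c_in zw(1,2) j i_act d_in u_def e_j flip: zw(3))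
  have "((x, s), (y, t)) \<in> ?\<sigma>"
    if "x \<in> X" "s \<in> carrier V" "y \<in> X" "t \<in> carrier V" "act D (d x) s = act D (d y) t" for x s y t
  proof -
    \<comment> \<open>By \<open>lift\<close>, both words evaluate to the same point of
      \<open>C\<close>, namely the image under \<open>i\<close> of the common value in
      \<open>D\<close>.\<close>
    have "((z x, w x \<otimes>\<^bsub>W\<^esub> j s), (z y, w y \<otimes>\<^bsub>W\<^esub> j t)) \<in> \<tau>"
      using that by (intro subsetD[OF ker_\<tau>]) (simp add: zw(1,2) j lift)
    then have "((z x, u x \<otimes>\<^bsub>V\<^esub> s), (z y, u y \<otimes>\<^bsub>V\<^esub> t)) \<in> ?\<sigma>"
      using that by (simp add: \<tau>_def q_def lift)
    with normal that show ?thesis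
      by (meson \<sigma>_sym \<sigma>_trans)
  qed
  then have "evaluation_kernel V D X d \<subseteq> ?\<sigma>"
    by (auto simp: evaluation_kernel_def)
  moreover have "?\<sigma> \<subseteq> evaluation_kernel V D X d"
    using d_in by (intro generated_congruence_least act_congruence_evaluation_kernel assms(2) H) auto
  moreover have "\<exists>x\<in>X. \<exists>s\<in>carrier V. a = act D (d x) s" if "a \<in> points D" for a
  proof -
    \<comment> \<open>Applying \<open>p\<close> to an expression of \<open>i a\<close> by generators
      of \<open>C\<close> gives one of \<open>a\<close> by generators of \<open>D\<close>.\<close>
    obtain x k where "x \<in> X" "k \<in> carrier W" "i a = act C (c x) k"
      using c_gen i \<open>a \<in> points D\<close> by blast
    then show ?thesis
      using d_act[of x k] p_i[OF \<open>a \<in> points D\<close>] e c_in by metis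
  qed
  ultimately have "presented_by V D X H"
    using d_in by (intro presented_byI[OF assms(2) X, of d]) auto
  moreover have "finite H"
    using fin by (simp add: H_def)
  ultimately show ?thesis
    using fin unfolding finitely_presented_act_def by blast
qed

section \<open>The two coordinates of the wreath product\<close>

theorem proposition5p2:
  fixes M :: "('m, 'k) monoid_scheme" and N :: "('n, 'l) monoid_scheme"
    and A :: "('m, 'a) right_act" and B :: "('n, 'b) right_act"
  assumes "monoid M" and "monoid N"
    and "monoid_act M A" and "monoid_act N B"
    and "finitely_presented_act (wreath_monoid M N A) (wreath_act A B)"
  shows "finitely_presented_act M A \<and> finitely_presented_act N B"
proof
  interpret A: monoid_act M A by fact
  interpret B: monoid_act N B by fact
  note wreath = monoid_act_wreath_act[OF assms(3,4)]
  obtain a0 where a0: "a0 \<in> points A"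
    using A.points_nonempty by blast
  obtain b0 where b0: "b0 \<in> points B"
    using B.points_nonempty by blast
  \<comment> \<open>The constant map with value the identity of \<open>N\<close> fixes the second
    coordinate \<open>b0\<close>, so the section is equivariant.\<close>
  show "finitely_presented_act M A"
    by (rule finitely_presented_act_transfer[OF wreath assms(3), where p = fst
          and e = "\<lambda>c. fst" and i = "\<lambda>a. (a, b0)" and j = "\<lambda>m. (m, \<lambda>a\<in>points A. \<one>\<^bsub>N\<^esub>)"])
      (use assms(5) b0 in \<open>auto simp: B.act_one\<close>)
  \<comment> \<open>Here the identity of \<open>M\<close> fixes \<open>a0\<close>, and the constant
    map \<open>n\<close> moves the second coordinate by \<open>n\<close>.\<close>
  show "finitely_presented_act N B"
    by (rule finitely_presented_act_transfer[OF wreath assms(4), where p = snd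
          and e = "\<lambda>c w. snd w (fst c)" and i = "\<lambda>b. (a0, b)"
          and j = "\<lambda>n. (\<one>\<^bsub>M\<^esub>, \<lambda>a\<in>points A. n)"])
      (use assms(5) a0 in \<open>auto simp: A.act_one\<close>)
qed

end
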